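(* Let $L$ be a closed subgroup of $GL_n(\mathbb{R})\ltimes\mathbb{R}^n$ whose linear part $\mathscr{L}(L)$ is closed in $GL_n(\mathbb{R})$, and let $H$ be a subset of $GL_n(\mathbb{R})\ltimes\mathbb{R}^n$. If the pair $(L,\mathbb{R}^n)$ is (CI) and $\mathscr{L}(L)\pitchfork\mathscr{L}(H)$ in $GL_n(\mathbb{R})$, then $L\pitchfork H$ in $GL_n(\mathbb{R})\ltimes\mathbb{R}^n$.
   Context: For subsets $L,H$ of a locally compact group $G$, one writes $L\pitchfork H$ in $G$ (the pair is proper) if $L\cap CHC^{-1}$ is relatively compact for every compact subset $C\subset G$, where $CHC^{-1}=\{chd^{-1}: c,d\in C,\ h\in H\}$. A pair $(L,H)$ of closed subgroups of a Lie group $G$ is (CI) if $L\cap gHg^{-1}$ is compact for every $g\in G$. The group $GL_n(\mathbb{R})\ltimes\mathbb{R}^n$ is realized as the matrices $(g,v):=\begin{pmatrix} g & v\\ 0&1\end{pmatrix}\in GL_{n+1}(\mathbb{R})$ with $g\in GL_n(\mathbb{R})$, $v\in\mathbb{R}^n$; $\mathscr{L}\colon GL_n(\mathbb{R})\ltimes\mathbb{R}^n\to GL_n(\mathbb{R})$, $\mathscr{L}(g,v)=g$, is the linear part, and $\mathbb{R}^n$ denotes the subgroup of translations $\{(I,v)\}$. *)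

theory Defs
  imports "HOL-Analysis.Analysis" "HOL-Algebra.Group"
begin

text \<open>
  Every group below is a HOL-Algebra group whose carrier is a subset of a topological space
  (here: of a matrix space), and carries the subspace topology.
\<close>

abbreviation group_topology :: "('a::topological_space) monoid \<Rightarrow> 'a topology" where
  "group_topology G \<equiv> top_of_set (carrier G)"

definition relatively_compact_in :: "'a topology \<Rightarrow> 'a set \<Rightarrow> bool" where
  "relatively_compact_in X S \<longleftrightarrow> compactin X (X closure_of S)"

definition closed_subgroup :: "'a set \<Rightarrow> ('a::topological_space) monoid \<Rightarrow> bool" where
  "closed_subgroup L G \<longleftrightarrow> subgroup L G \<and> closedin (group_topology G) L"

text \<open>Intended for subsets \<open>L\<close>, \<open>H\<close> of the carrier of \<open>G\<close>.\<close>

definition proper_pair :: "('a::topological_space) monoid \<Rightarrow> 'a set \<Rightarrow> 'a set \<Rightarrow> bool" where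
  "proper_pair G L H \<longleftrightarrow>
     (\<forall>C. compactin (group_topology G) C \<longrightarrow>
        relatively_compact_in (group_topology G)
          (L \<inter> {c \<otimes>\<^bsub>G\<^esub> h \<otimes>\<^bsub>G\<^esub> inv\<^bsub>G\<^esub> d | c h d. c \<in> C \<and> h \<in> H \<and> d \<in> C}))"

definition CI_pair :: "('a::topological_space) monoid \<Rightarrow> 'a set \<Rightarrow> 'a set \<Rightarrow> bool" where
  "CI_pair G L H \<longleftrightarrow> closed_subgroup L G \<and> closed_subgroup H G \<and>
     (\<forall>g\<in>carrier G. compactin (group_topology G) (L \<inter> {g \<otimes>\<^bsub>G\<^esub> h \<otimes>\<^bsub>G\<^esub> inv\<^bsub>G\<^esub> g | h. h \<in> H}))"

definition GL_group :: "(real^'n^'n) monoid" where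
  "GL_group = \<lparr>carrier = {A. invertible A}, mult = (**), one = mat 1\<rparr>"

text \<open>
  Square matrices of size \<open>n + 1\<close> are indexed by \<^typ>\<open>'n option\<close>,
  with \<^const>\<open>None\<close> as the last index.
\<close>

definition affine_matrix :: "real^'n^'n \<Rightarrow> real^'n \<Rightarrow> real^('n option)^('n option)" where
  "affine_matrix g v = (\<chi> i j.
     case (i, j) of
       (Some k, Some l) \<Rightarrow> g $ k $ l
     | (Some k, None) \<Rightarrow> v $ k
     | (None, Some l) \<Rightarrow> 0
     | (None, None) \<Rightarrow> 1)"

definition affine_group :: "(real^('n::finite option)^('n option)) monoid" where
  "affine_group = GL_group\<lparr>carrier := {affine_matrix g v | g v. g \<in> carrier GL_group}\<rparr>"

text \<open>Total on all matrices, but only meaningful on the carrier of \<^const>\<open>affine_group\<close>.\<close>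

definition linear_part :: "real^('n::finite option)^('n option) \<Rightarrow> real^'n^'n" where
  "linear_part A = (\<chi> i j. A $ Some i $ Some j)"

definition translation_group :: "(real^('n::finite option)^('n option)) set" where
  "translation_group = range (affine_matrix (mat 1))"

lemma linear_part_affine_matrix [simp]: "linear_part (affine_matrix g v) = g"
  by (simp add: linear_part_def affine_matrix_def vec_eq_iff)

lemma sum_option_UNIV:
  fixes f :: "'n::finite option \<Rightarrow> real"
  shows "(\<Sum>i\<in>UNIV. f i) = f None + (\<Sum>i\<in>UNIV. f (Some i))"
  by (simp add: UNIV_option_conv sum.reindex)

lemma affine_matrix_mult:
  "affine_matrix g v ** affine_matrix h w = affine_matrix (g ** h) (g *v w + v)"
  by (auto simp: affine_matrix_def matrix_matrix_mult_def matrix_vector_mult_def vec_eq_iff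
      sum_option_UNIV split: option.splits)

lemma affine_matrix_one: "affine_matrix (mat 1) 0 = mat 1"
  by (auto simp: affine_matrix_def mat_def vec_eq_iff split: option.splits)

lemma invertible_mat_1: "invertible (mat 1 :: real^'n^'n)"
  unfolding invertible_def by (metis matrix_mul_lid)

lemma group_GL: "group (GL_group :: (real^'n^'n) monoid)"
proof (rule groupI)
  fix A :: "real^'n^'n" assume "A \<in> carrier GL_group"
  then show "\<exists>B\<in>carrier GL_group. B \<otimes>\<^bsub>GL_group\<^esub> A = \<one>\<^bsub>GL_group\<^esub>"
    unfolding GL_group_def invertible_def by auto
qed (auto simp: GL_group_def matrix_mul_assoc invertible_mat_1 intro: invertible_mult)

lemma affine_matrix_inverse:
  assumes "g ** h = mat 1" and "h ** g = mat 1"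
  shows "affine_matrix g v ** affine_matrix h (- (h *v v)) = mat 1"
    and "affine_matrix h (- (h *v v)) ** affine_matrix g v = mat 1"
proof -
  have "g *v (- (h *v v)) = - v"
    using assms(1) by (simp add: vec.neg matrix_vector_mul_assoc)
  then show "affine_matrix g v ** affine_matrix h (- (h *v v)) = mat 1"
    using assms(1) by (simp add: affine_matrix_mult affine_matrix_one)
  show "affine_matrix h (- (h *v v)) ** affine_matrix g v = mat 1"
    using assms(2) by (simp add: affine_matrix_mult affine_matrix_one)
qed

lemma subgroup_affine:
  "subgroup (carrier affine_group) (GL_group :: (real^('n::finite option)^('n option)) monoid)"
proof -
  have C: "carrier affine_group = {affine_matrix g v | g v. invertible g}"
    by (simp add: affine_group_def GL_group_def)
  have inverse: "\<exists>h w. invertible h \<and> affine_matrix g v ** affine_matrix h w = mat 1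
      \<and> affine_matrix h w ** affine_matrix g v = mat 1"
    if g: "invertible g" for g :: "real^'n^'n" and v
  proof -
    obtain h where "g ** h = mat 1" "h ** g = mat 1"
      using g unfolding invertible_def by blast
    then show ?thesis
      using affine_matrix_inverse[of g h v] unfolding invertible_def by blast
  qed
  interpret GL: group "GL_group :: (real^('n option)^('n option)) monoid"
    by (rule group_GL)
  have sub: "carrier affine_group \<subseteq> carrier (GL_group :: (real^('n option)^('n option)) monoid)"
    unfolding C using inverse by (fastforce simp: GL_group_def invertible_def)
  show ?thesis
  proof (rule GL.subgroupI)
    show "carrier affine_group \<noteq> ({} :: (real^('n option)^('n option)) set)"
      unfolding C using invertible_mat_1 by blast
  next
    fix A :: "real^('n option)^('n option)" assume A: "A \<in> carrier affine_group"
    then obtain g :: "real^'n^'n" and v where gv: "A = affine_matrix g v" "invertible g"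
      unfolding C by blast
    obtain h w where hw: "invertible h" "affine_matrix g v ** affine_matrix h w = mat 1"
        "affine_matrix h w ** affine_matrix g v = mat 1"
      using inverse[OF gv(2), of v] by blast
    then have "affine_matrix h w \<in> carrier affine_group"
      unfolding C by blast
    moreover have "inv\<^bsub>GL_group\<^esub> A = affine_matrix h w"
      by (rule GL.inv_equality)
        (use hw gv A sub calculation in \<open>auto simp: GL_group_def\<close>)
    ultimately show "inv\<^bsub>GL_group\<^esub> A \<in> carrier affine_group" by simp
  next
    fix A B :: "real^('n option)^('n option)"
    assume "A \<in> carrier affine_group" "B \<in> carrier affine_group"
    then obtain g h :: "real^'n^'n" and v w
      where "A = affine_matrix g v" "invertible g" "B = affine_matrix h w" "invertible h"
      unfolding C by blast
    then show "A \<otimes>\<^bsub>GL_group\<^esub> B \<in> carrier affine_group"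
      unfolding C by (auto simp: GL_group_def affine_matrix_mult intro: invertible_mult)
  qed (rule sub)
qed

lemma group_affine: "group (affine_group :: (real^('n::finite option)^('n option)) monoid)"
proof -
  have "affine_group = GL_group\<lparr>carrier := carrier (affine_group
      :: (real^('n option)^('n option)) monoid)\<rparr>"
    by (simp add: affine_group_def)
  then show ?thesis
    using subgroup.subgroup_is_group[OF subgroup_affine group_GL] by metis
qed

lemma closed_subgroup_translation_group:
  "closed_subgroup translation_group
    (affine_group :: (real^('n::finite option)^('n option)) monoid)"
proof -
  interpret A: group "affine_group :: (real^('n option)^('n option)) monoid"
    by (rule group_affine)
  have mult: "mult affine_group = ((**) :: real^('n option)^('n option) \<Rightarrow> _)"
    and one: "one affine_group = (mat 1 :: real^('n option)^('n option))"
    by (simp_all add: affine_group_def GL_group_def)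
  have sub: "translation_group \<subseteq> carrier (affine_group :: (real^('n option)^('n option)) monoid)"
    unfolding translation_group_def affine_group_def GL_group_def
    using invertible_mat_1 by auto
  have "subgroup translation_group (affine_group :: (real^('n option)^('n option)) monoid)"
  proof (rule A.subgroupI)
    fix A :: "real^('n option)^('n option)" assume "A \<in> translation_group"
    then obtain v :: "real^'n" where v: "A = affine_matrix (mat 1) v"
      by (auto simp: translation_group_def)
    have "inv\<^bsub>affine_group\<^esub> A = affine_matrix (mat 1) (- v)"
      by (rule A.inv_equality)
        (use v sub in \<open>auto simp: mult one affine_matrix_mult affine_matrix_one translation_group_def\<close>)
    then show "inv\<^bsub>affine_group\<^esub> A \<in> translation_group"
      by (simp add: translation_group_def)
  qed (use sub in \<open>auto simp: mult translation_group_def affine_matrix_mult\<close>)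
  moreover have "translation_group =
      carrier affine_group \<inter> {A :: real^('n option)^('n option). linear_part A = mat 1}"
    using sub by (auto simp: translation_group_def affine_group_def)
  moreover have "closed {A :: real^('n option)^('n option). linear_part A = mat 1}"
    unfolding linear_part_def by (intro closed_Collect_eq continuous_intros)
  ultimately show ?thesis
    unfolding closed_subgroup_def by (metis closedin_closed_Int)
qed

end

theory Submission
  imports Defs "HOL-Algebra.Coset"
begin

text \<open>
  A compact subgroup of \<open>\<real>\<^sup>n\<close> is trivial, so (CI) says that the linear part is injective on \<open>L\<close>.
  It is thus a continuous isomorphism from the \<open>\<sigma>\<close>-compact group \<open>L\<close> onto its image, which is closed
  in \<open>GL\<^sub>n(\<real>)\<close> and hence locally compact.  By the open mapping theorem for such groups, a consequence
  of Baire's theorem, the isomorphism is proper: the elements of \<open>L\<close> with linear part in a compact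
  subset of the image form a compact set (\<open>compactin_preimage_of_bijective_hom\<close>).

  The linear part, being a homomorphism, sends \<open>L \<inter> CHC\<^sup>-\<^sup>1\<close> into the intersection of the linear
  parts of \<open>L\<close> and of \<open>CHC\<^sup>-\<^sup>1\<close>, which is relatively compact by properness of the pair of linear
  parts; its closure stays in the image of \<open>L\<close>, because that image is closed.  The preimage of this
  closure in \<open>L\<close> is then a compact set that contains \<open>L \<inter> CHC\<^sup>-\<^sup>1\<close>.
\<close>

section \<open>Continuous bijective homomorphisms of \<open>\<sigma>\<close>-compact groups\<close>

text \<open>
  The open mapping theorem, in the form that is used below.  By Baire's theorem the image of one of
  the countably many compact pieces \<open>D m\<close> has interior points.  Translates of this interior cover
  \<open>K\<close>; finitely many suffice, and by injectivity the corresponding translates of \<open>D m\<close>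
  cover the preimage of \<open>K\<close>.
\<close>

lemma compactin_preimage_of_bijective_hom:
  fixes G :: "('a, 'c) monoid_scheme" (structure) and M :: "('b, 'd) monoid_scheme" and D :: "nat \<Rightarrow> 'a set"
  assumes hom: "group_hom G M h"
    and bij: "bij_betw h (carrier G) (carrier M)"
    and X: "topspace X = carrier G" and Y: "topspace Y = carrier M"
    and cont: "continuous_map X Y h"
    and transX: "\<And>g. g \<in> carrier G \<Longrightarrow> continuous_map X X (\<lambda>x. g \<otimes> x)"
    and transY: "\<And>g. g \<in> carrier M \<Longrightarrow> continuous_map Y Y (\<lambda>y. g \<otimes>\<^bsub>M\<^esub> y)"
    and lc: "locally_compact_space Y" and hd: "Hausdorff_space Y"
    and D: "\<And>m. compactin X (D m)" "(\<Union>m. D m) = carrier G"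
    and K: "compactin Y K"
  shows "compactin X {x \<in> carrier G. h x \<in> K}"
proof -
  interpret group_hom G M h by fact
  have closed_image: "closedin Y (h ` D m)" for m
    using compactin_imp_closedin[OF hd] image_compactin[OF D(1) cont] by blast
  have "\<exists>m. Y interior_of (h ` D m) \<noteq> {}"
  proof (rule ccontr)
    assume "\<not> ?thesis"
    then have "Y interior_of (\<Union>m. h ` D m) = {}"
      using closed_image lc locally_compact_Hausdorff_imp_regular_space[OF lc hd]
      by (intro Baire_category_alt) auto
    moreover have "(\<Union>m. h ` D m) = topspace Y"
      using bij D(2) Y by (metis bij_betw_imp_surj_on image_UN)
    ultimately show False
      using Y H.one_closed interior_of_topspace[of Y] by auto
  qed
  then obtain m u where u: "u \<in> Y interior_of (h ` D m)" by blast
  define U where "U = Y interior_of (h ` D m)"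
  have U: "openin Y U" "U \<subseteq> h ` D m" "u \<in> U"
    using u by (auto simp: U_def interior_of_subset)
  have Dm: "D m \<subseteq> carrier G" using D(2) by blast
  obtain l0 where l0: "l0 \<in> carrier G" "h l0 = u"
    using U Dm by blast
  define V where "V g = {y \<in> topspace Y. h (inv g) \<otimes>\<^bsub>M\<^esub> y \<in> U}" for g
  have openV: "openin Y (V g)" if "g \<in> carrier G" for g
    unfolding V_def using that U(1) transY[of "h (inv g)"]
    by (intro openin_continuous_map_preimage) auto
  have "K \<subseteq> (\<Union>g\<in>carrier G. V g)"
  proof
    fix y assume "y \<in> K"
    then have y: "y \<in> carrier M" using compactin_subset_topspace[OF K] Y by blast
    then obtain x where x: "x \<in> carrier G" "h x = y"
      using bij by (metis bij_betw_imp_surj_on imageE)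
    \<comment> \<open>the translation by this element moves \<open>u\<close> to \<open>y\<close>\<close>
    define g where "g = x \<otimes> inv l0"
    have g: "g \<in> carrier G" using x l0 by (simp add: g_def)
    have "inv g \<otimes> x = l0"
      using x l0 by (simp add: g_def G.inv_mult_group G.m_assoc)
    then have "h (inv g) \<otimes>\<^bsub>M\<^esub> y = u"
      using x g l0 by (metis G.inv_closed hom_mult)
    then show "y \<in> (\<Union>g\<in>carrier G. V g)"
      using g y Y U(3) by (auto simp: V_def)
  qed
  then obtain \<F> where \<F>: "finite \<F>" "\<F> \<subseteq> V ` carrier G" "K \<subseteq> \<Union>\<F>"
    using compactinD[OF K, of "V ` carrier G"] openV by blast
  then obtain F where F: "finite F" "F \<subseteq> carrier G" "\<F> = V ` F"
    by (meson finite_subset_image)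
  have "compactin X (\<Union>g\<in>F. (\<lambda>x. g \<otimes> x) ` D m)"
    using F transX by (intro compactin_Union) (auto intro!: image_compactin[OF D(1)])
  moreover have "{x \<in> carrier G. h x \<in> K} \<subseteq> (\<Union>g\<in>F. (\<lambda>x. g \<otimes> x) ` D m)"
  proof clarify
    fix x assume x: "x \<in> carrier G" "h x \<in> K"
    then obtain g where g: "g \<in> F" "h x \<in> V g" using \<F> F by blast
    then have gG: "g \<in> carrier G" using F by blast
    have "h (inv g \<otimes> x) \<in> h ` D m"
      using g gG x U(2) by (auto simp: V_def)
    then have "inv g \<otimes> x \<in> D m"
      using bij Dm gG x by (metis G.inv_closed G.m_closed bij_betw_imp_inj_on inj_on_image_mem_iff)
    moreover have "x = g \<otimes> (inv g \<otimes> x)"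
      using gG x by (simp add: G.m_assoc[symmetric])
    ultimately show "x \<in> (\<Union>g\<in>F. (\<lambda>x. g \<otimes> x) ` D m)"
      using g(1) by blast
  qed
  moreover have "closedin X {x \<in> carrier G. h x \<in> K}"
    using closedin_continuous_map_preimage[OF cont compactin_imp_closedin[OF hd K]] X by simp
  ultimately show ?thesis by (rule closed_compactin)
qed

lemma relatively_compact_in_subset_compactin:
  assumes "Hausdorff_space X" "compactin X K" "S \<subseteq> K"
  shows "relatively_compact_in X S"
  unfolding relatively_compact_in_def
  using assms by (meson closed_compactin closedin_closure_of closure_of_minimal compactin_imp_closedin)

section \<open>The topology of the matrix groups\<close>

lemma GL_group_simps:
  "carrier GL_group = {A :: real^'n^'n. invertible A}"
  "mult GL_group = ((**) :: real^'n^'n \<Rightarrow> _)"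
  "one GL_group = (mat 1 :: real^'n^'n)"
  by (simp_all add: GL_group_def)

lemma affine_group_simps:
  "carrier affine_group = {affine_matrix g v | (g :: real^'n^'n) v. invertible g}"
  "mult affine_group = ((**) :: real^('n::finite option)^('n option) \<Rightarrow> _)"
  "one affine_group = (mat 1 :: real^('n option)^('n option))"
  by (simp_all add: affine_group_def GL_group_def)

lemma continuous_on_matrix_mult_left:
  "continuous_on S (\<lambda>x :: real^'n^'n. g ** x)"
  unfolding matrix_matrix_mult_def by (intro continuous_intros)

lemma continuous_on_linear_part: "continuous_on S linear_part"
  unfolding linear_part_def by (intro continuous_intros)

lemma open_carrier_GL_group: "open (carrier GL_group :: (real^'n^'n) set)"
proof -
  have "continuous_on UNIV (det :: real^'n^'n \<Rightarrow> real)"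
    unfolding det_def by (intro continuous_intros)
  then have "open {A :: real^'n^'n. det A \<noteq> 0}"
    by (intro open_Collect_neq continuous_intros)
  then show ?thesis
    by (simp add: GL_group_simps invertible_det_nz)
qed

lemma continuous_on_affine_matrix:
  "continuous_on S (\<lambda>(g, v). affine_matrix g v :: real^('n::finite option)^('n option))"
proof -
  have "continuous_on S (\<lambda>x. affine_matrix (fst x) (snd x) $ i $ j)" for i j :: "'n option"
    by (cases i; cases j) (auto simp: affine_matrix_def intro!: continuous_intros)
  then have "continuous_on S (\<lambda>x. \<chi> i j. affine_matrix (fst x) (snd x) $ i $ j)"
    by (intro continuous_on_vec_lambda)
  then show ?thesis
    by (simp add: case_prod_unfold)
qed

text \<open>
  The affine group is a continuous image of the open set \<open>GL\<^sub>n(\<real>) \<times> \<real>\<^sup>n\<close> in a Euclidean space.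
\<close>

lemma affine_group_sigma_compact:
  obtains D :: "nat \<Rightarrow> (real^('n::finite option)^('n option)) set"
  where "\<And>m. compact (D m)" "(\<Union>m. D m) = carrier affine_group"
proof -
  have "open ((carrier GL_group :: (real^'n^'n) set) \<times> (UNIV :: (real^'n) set))"
    by (intro open_Times open_carrier_GL_group open_UNIV)
  then obtain C where C: "\<And>m :: nat. compact (C m)"
      "\<Union>(range C) = (carrier GL_group :: (real^'n^'n) set) \<times> (UNIV :: (real^'n) set)"
    by (metis open_Union_compact_subsets)
  show thesis
  proof
    show "compact ((\<lambda>(g, v). affine_matrix g v) ` C m)" for m
      by (intro compact_continuous_image continuous_on_affine_matrix C)
    have "(\<Union>m. (\<lambda>(g, v). affine_matrix g v) ` C m) = (\<lambda>(g, v). affine_matrix g v) ` \<Union>(range C)"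
      by blast
    then show "(\<Union>m. (\<lambda>(g, v). affine_matrix g v) ` C m) = carrier affine_group"
      unfolding C(2) by (auto simp: affine_group_simps GL_group_simps)
  qed
qed

lemma linear_part_hom:
  "group_hom affine_group GL_group (linear_part :: real^('n::finite option)^('n option) \<Rightarrow> _)"
  by (auto simp: group_hom_def group_hom_axioms_def group_affine group_GL hom_def
      affine_group_simps GL_group_simps affine_matrix_mult)

section \<open>Subgroups with a bounded set of translations\<close>

lemma affine_matrix_translation_power:
  assumes "subgroup L affine_group" and "affine_matrix (mat 1) v \<in> L"
  shows "affine_matrix (mat 1) (real k *\<^sub>R v) \<in> L"
proof (induction k)
  case 0
  show ?case
    using subgroup.one_closed[OF assms(1)] by (simp add: affine_matrix_one affine_group_simps)
next
  case (Suc k)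
  have "affine_matrix (mat 1) (real k *\<^sub>R v) ** affine_matrix (mat 1) v \<in> L"
    using subgroup.m_closed[OF assms(1) Suc assms(2)] by (simp add: affine_group_simps)
  then show ?case
    by (simp add: affine_matrix_mult algebra_simps)
qed

text \<open>The powers of a nontrivial translation are unbounded.\<close>

lemma translation_trivial_if_bounded:
  fixes v :: "real^'n"
  assumes L: "subgroup L affine_group"
    and bounded: "bounded (L \<inter> translation_group)"
    and v: "affine_matrix (mat 1) v \<in> L"
  shows "v = 0"
proof -
  obtain B where B: "norm A \<le> B" if "A \<in> L \<inter> translation_group" for A
    using bounded by (auto simp: bounded_iff)
  have "v $ i = 0" for i
  proof (rule ccontr)
    assume "v $ i \<noteq> 0"
    then obtain k where k: "B < real k * \<bar>v $ i\<bar>"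
      using reals_Archimedean3[of "\<bar>v $ i\<bar>"] by auto
    let ?A = "affine_matrix (mat 1) (real k *\<^sub>R v)"
    have "real k * \<bar>v $ i\<bar> = norm (?A $ Some i $ None)"
      by (simp add: affine_matrix_def abs_mult)
    also have "\<dots> \<le> norm ?A"
      by (meson order_trans Finite_Cartesian_Product.norm_nth_le)
    also have "\<dots> \<le> B"
      using affine_matrix_translation_power[OF L v] by (intro B) (auto simp: translation_group_def)
    finally show False using k by simp
  qed
  then show ?thesis by (simp add: vec_eq_iff)
qed

text \<open>
  The translations in \<open>L\<close> are the kernel of the linear part on \<open>L\<close>, and (CI) at \<open>g = 1\<close> makes them
  a compact set.
\<close>

lemma inj_on_linear_part_if_CI:
  fixes L :: "(real^('n::finite option)^('n option)) set"
  assumes CI: "CI_pair affine_group L translation_group"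
  shows "inj_on linear_part L"
proof -
  interpret A: group "affine_group :: (real^('n option)^('n option)) monoid" by (rule group_affine)
  interpret lin: group_hom affine_group GL_group "linear_part :: real^('n option)^('n option) \<Rightarrow> _"
    by (rule linear_part_hom)
  have L: "subgroup L affine_group"
    using CI by (simp add: CI_pair_def closed_subgroup_def)
  have T: "translation_group \<subseteq> carrier (affine_group :: (real^('n option)^('n option)) monoid)"
    using closed_subgroup_translation_group subgroup.subset by (auto simp: closed_subgroup_def)
  let ?conj = "\<lambda>h :: real^('n option)^('n option).
    \<one>\<^bsub>affine_group\<^esub> \<otimes>\<^bsub>affine_group\<^esub> h \<otimes>\<^bsub>affine_group\<^esub> inv\<^bsub>affine_group\<^esub> \<one>\<^bsub>affine_group\<^esub>"
  have "?conj h = h" if "h \<in> translation_group" for h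
    using that T by (simp add: subset_iff)
  then have conj: "{?conj h | h. h \<in> translation_group} = translation_group"
    by (simp add: Setcompr_eq_image)
  have "compactin (group_topology affine_group) (L \<inter> {?conj h | h. h \<in> translation_group})"
    using CI[unfolded CI_pair_def, THEN conjunct2, THEN conjunct2] A.one_closed by (rule bspec)
  then have "compactin (group_topology affine_group) (L \<inter> translation_group)"
    by (simp only: conj)
  then have bounded: "bounded (L \<inter> translation_group)"
    by (simp add: compactin_subtopology compact_imp_bounded)
  interpret L: group_hom "affine_group\<lparr>carrier := L\<rparr>" GL_group linear_part
    using subgroup.subgroup_is_group[OF L group_affine] subgroup.subset[OF L] lin.hom_mult
      lin.hom_closed
    by (auto simp: group_hom_def group_hom_axioms_def hom_def group_GL subset_iff)
  have "inj_on linear_part (carrier (affine_group\<lparr>carrier := L\<rparr>))"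
    unfolding L.inj_on_one_iff
  proof clarsimp
    fix x assume x: "x \<in> L" "linear_part x = \<one>\<^bsub>GL_group\<^esub>"
    then obtain v where v: "x = affine_matrix (mat 1) v"
      using subgroup.subset[OF L] by (fastforce simp: affine_group_simps GL_group_simps)
    then have "v = 0"
      using translation_trivial_if_bounded[OF L bounded] x by blast
    then show "x = \<one>\<^bsub>affine_group\<^esub>"
      using v by (simp add: affine_matrix_one affine_group_simps)
  qed
  then show ?thesis by simp
qed

section \<open>Properness of the linear part and of the pair\<close>

text \<open>
  Closedness of \<open>L\<close> makes \<open>L\<close> a \<open>\<sigma>\<close>-compact group, and closedness of its linear part makes that
  image locally compact, so the open mapping theorem above applies to \<open>L\<close> and its linear part.
\<close>

lemma compact_linear_part_preimage:
  fixes L :: "(real^('n::finite option)^('n option)) set"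
  assumes L: "closed_subgroup L affine_group"
    and closed: "closedin (group_topology GL_group) (linear_part ` L)"
    and inj: "inj_on linear_part L"
    and K: "compact K" "K \<subseteq> linear_part ` L"
  shows "compact {x \<in> L. linear_part x \<in> K}"
proof -
  interpret lin: group_hom affine_group GL_group "linear_part :: real^('n option)^('n option) \<Rightarrow> _"
    by (rule linear_part_hom)
  have sub: "subgroup L affine_group"
    using L by (simp add: closed_subgroup_def)
  have image: "subgroup (linear_part ` L) GL_group"
    using sub by (rule lin.subgroup_img_is_subgroup)
  obtain D :: "nat \<Rightarrow> (real^('n option)^('n option)) set"
    where D: "\<And>m. compact (D m)" "(\<Union>m. D m) = carrier affine_group"
    by (metis affine_group_sigma_compact)
  have compact_pieces: "compact (L \<inter> D m)" for m
  proof -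
    have "compactin (group_topology affine_group) (D m)"
      using D by (auto simp: compactin_subtopology)
    then have "compactin (group_topology affine_group) (L \<inter> D m)"
      using L by (intro closed_Int_compactin) (auto simp: closed_subgroup_def)
    then show ?thesis by (simp add: compactin_subtopology)
  qed
  let ?G = "affine_group\<lparr>carrier := L\<rparr>" and ?M = "GL_group\<lparr>carrier := linear_part ` L\<rparr>"
  have "compactin (top_of_set L) {x \<in> carrier ?G. linear_part x \<in> K}"
  proof (rule compactin_preimage_of_bijective_hom[where M = ?M and Y = "top_of_set (linear_part ` L)"
        and D = "\<lambda>m. L \<inter> D m"])
    show "group_hom ?G ?M linear_part"
      using subgroup.subgroup_is_group[OF sub group_affine]
        subgroup.subgroup_is_group[OF image group_GL] subgroup.subset[OF sub] lin.hom_mult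
      by (auto simp: group_hom_def group_hom_axioms_def hom_def subset_iff)
    show "bij_betw linear_part (carrier ?G) (carrier ?M)"
      using inj by (simp add: bij_betw_def)
    show "continuous_map (top_of_set L) (top_of_set (linear_part ` L)) linear_part"
      using continuous_on_linear_part by auto
    show "continuous_map (top_of_set L) (top_of_set L) (\<lambda>x. g \<otimes>\<^bsub>?G\<^esub> x)" if "g \<in> carrier ?G" for g
      using that subgroup.m_closed[OF sub]
      by (auto simp: affine_group_simps continuous_on_matrix_mult_left)
    show "continuous_map (top_of_set (linear_part ` L)) (top_of_set (linear_part ` L))
        (\<lambda>y. g \<otimes>\<^bsub>?M\<^esub> y)" if "g \<in> carrier ?M" for g
      using that subgroup.m_closed[OF image]
      by (auto simp: GL_group_simps continuous_on_matrix_mult_left)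
    show "locally_compact_space (top_of_set (linear_part ` L))"
    proof -
      have "locally_compact_space (group_topology (GL_group :: (real^'n^'n) monoid))"
        using open_carrier_GL_group
        by (intro locally_compact_space_open_subset locally_compact_space_euclidean) auto
      then have "locally_compact_space (subtopology (group_topology GL_group) (linear_part ` L))"
        using closed by (rule locally_compact_space_closed_subset)
      then show ?thesis
        using subgroup.subset[OF image] by (simp add: subtopology_subtopology inf.absorb2)
    qed
    show "compactin (top_of_set L) (L \<inter> D m)" for m
      using compact_pieces by (simp add: compactin_subtopology)
    show "(\<Union>m. L \<inter> D m) = carrier ?G"
      using D(2) subgroup.subset[OF sub] by auto
    show "compactin (top_of_set (linear_part ` L)) K"
      using K by (simp add: compactin_subtopology)
  qed (auto simp: Hausdorff_space_subtopology)
  then show ?thesis by (simp add: compactin_subtopology)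
qed

theorem theorem1p6:
  fixes L H :: "(real^('n::finite option)^('n option)) set"
  assumes "closed_subgroup L affine_group"
    and "closedin (group_topology GL_group) (linear_part ` L)"
    and "H \<subseteq> carrier affine_group"
    and "CI_pair affine_group L translation_group"
    and "proper_pair GL_group (linear_part ` L) (linear_part ` H)"
  shows "proper_pair affine_group L H"
  unfolding proper_pair_def
proof (intro allI impI)
  fix C :: "(real^('n option)^('n option)) set"
  assume C: "compactin (group_topology affine_group) C"
  interpret lin: group_hom affine_group GL_group "linear_part :: real^('n option)^('n option) \<Rightarrow> _"
    by (rule linear_part_hom)
  let ?S = "L \<inter> {c \<otimes>\<^bsub>affine_group\<^esub> h \<otimes>\<^bsub>affine_group\<^esub> inv\<^bsub>affine_group\<^esub> d | c h d.
    c \<in> C \<and> h \<in> H \<and> d \<in> C}"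
  let ?T = "linear_part ` L \<inter> {c \<otimes>\<^bsub>GL_group\<^esub> h \<otimes>\<^bsub>GL_group\<^esub> inv\<^bsub>GL_group\<^esub> d | c h d.
    c \<in> linear_part ` C \<and> h \<in> linear_part ` H \<and> d \<in> linear_part ` C}"
  define K where "K = group_topology GL_group closure_of ?T"
  have CA: "C \<subseteq> carrier affine_group"
    using C by (simp add: compactin_subtopology)
  have LA: "L \<subseteq> carrier affine_group"
    using assms(1) by (simp add: closed_subgroup_def subgroup.subset)
  have "compactin (group_topology GL_group) (linear_part ` C)"
    using C CA by (auto simp: compactin_subtopology
        intro!: compact_continuous_image continuous_on_linear_part)
  then have "compactin (group_topology GL_group) K"
    using assms(5) by (simp add: proper_pair_def relatively_compact_in_def K_def)
  then have "compact K"
    by (simp add: compactin_subtopology)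
  moreover have "K \<subseteq> linear_part ` L"
    unfolding K_def using assms(2) by (intro closure_of_minimal) auto
  ultimately have "compact {x \<in> L. linear_part x \<in> K}"
    by (rule compact_linear_part_preimage[OF assms(1,2) inj_on_linear_part_if_CI[OF assms(4)]])
  then have "compactin (group_topology affine_group) {x \<in> L. linear_part x \<in> K}"
    using LA by (auto simp: compactin_subtopology)
  moreover have "?S \<subseteq> {x \<in> L. linear_part x \<in> K}"
  proof
    fix x assume "x \<in> ?S"
    then obtain c h d where x: "x \<in> L"
        "x = c \<otimes>\<^bsub>affine_group\<^esub> h \<otimes>\<^bsub>affine_group\<^esub> inv\<^bsub>affine_group\<^esub> d"
      and chd: "c \<in> C" "h \<in> H" "d \<in> C"
      by blast
    have "c \<in> carrier affine_group" "h \<in> carrier affine_group" "d \<in> carrier affine_group"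
      using chd CA assms(3) by auto
    then have "linear_part x =
        linear_part c \<otimes>\<^bsub>GL_group\<^esub> linear_part h \<otimes>\<^bsub>GL_group\<^esub> inv\<^bsub>GL_group\<^esub> linear_part d"
      by (simp add: x(2))
    then have "linear_part x \<in> ?T"
      using x(1) chd by blast
    moreover have "?T \<subseteq> K"
      unfolding K_def
    proof (rule closure_of_subset)
      have "linear_part ` L \<subseteq> carrier GL_group"
        using LA lin.hom_closed by auto
      then show "?T \<subseteq> topspace (group_topology GL_group)"
        by (simp add: le_infI1)
    qed
    ultimately show "x \<in> {x \<in> L. linear_part x \<in> K}"
      using x(1) by blast
  qed
  ultimately show "relatively_compact_in (group_topology affine_group) ?S"
    by (intro relatively_compact_in_subset_compactin[OF Hausdorff_space_subtopology]) auto
qed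

end
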